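(* Let $n$ be even. Any D&C SPN of depth 3 over $x\in\{0,1\}^n$ which computes $\mathrm{EQUAL}(x)$ must have at least $2^{n/2}$ nodes in its second layer.
   Context: $\mathrm{EQUAL}:\{0,1\}^n\to\{0,1\}$ is defined by $\mathrm{EQUAL}(x)=1$ if $(x_1,\dots,x_{n/2})=(x_{n/2+1},\dots,x_n)$ and $0$ otherwise. Arithmetic circuits: an arithmetic circuit $\Phi$ over a tuple of variables $y$ is a finite directed acyclic graph with a unique node of out-degree $0$ (the root). Each node of in-degree $0$ is labeled by a variable of $y$ or a real constant; every other node is labeled $\times$ (product node) or $+$ (sum node), and edges into sum nodes carry real weights. The children $C(u)$ of $u$ are the nodes with an edge into $u$. Labeled leaves compute their labels, a product node computes $q_u=\prod_{v\in C(u)}q_v$, a sum node computes $q_u=\sum_{v\in C(u)}w_{v,u}q_v$; $q_\Phi$ is the polynomial computed by the root. $\Phi$ is monotone if all weights and constants are non-negative. SPNs: let $x_i\in\{0,1\}$ (with counting measure) and let $f$ be a tuple of non-negative univariate functions $f_{i,j}(x_i)$. A Sum Product Network (SPN) is a monotone arithmetic circuit over $f$; it computes the function $x\mapsto q_\Phi(f(x))$. The dependency-scope of a node $u$ is the set of those $x_i$ such that some $f_{i,j}$ labels a node in the sub-circuit rooted at $u$. An SPN is decomposable if for every product node the dependency-scopes of its children are pairwise disjoint, complete if for every sum node the dependency-scopes of its children are all equal, and a D&C SPN if it is both. Depth convention: the layer of input (leaf) nodes counts as the first layer. A depth-3 SPN thus consists of a first layer of leaves, a second layer of sum/product nodes whose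 children are leaves, and a third layer consisting of the root, whose children are second-layer nodes. *)

theory Defs
  imports Main HOL.Real "HOL-Library.Poly_Mapping" "HOL-Library.FuncSet" "HOL-Library.Disjoint_Sets"
begin

text \<open>Real multivariate polynomials in variables of type \<open>'v\<close>: finitely supported maps from
  monomials (exponent vectors) to coefficients.\<close>

type_synonym 'v rpoly = "('v \<Rightarrow>\<^sub>0 nat) \<Rightarrow>\<^sub>0 real"

definition poly_const :: "real \<Rightarrow> 'v rpoly" where
  "poly_const c = Poly_Mapping.single 0 c"

definition poly_var :: "'v \<Rightarrow> 'v rpoly" where
  "poly_var v = Poly_Mapping.single (Poly_Mapping.single v 1) 1"

definition poly_eval :: "('v \<Rightarrow> real) \<Rightarrow> 'v rpoly \<Rightarrow> real" where
  "poly_eval a p =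
    (\<Sum>m\<in>Poly_Mapping.keys p. Poly_Mapping.lookup p m *
       (\<Prod>v\<in>Poly_Mapping.keys m. a v ^ Poly_Mapping.lookup m v))"

datatype 'v label = Var 'v | Const real | Prod | Sum

text \<open>An edge \<open>(v, u)\<close> goes from the child \<open>v\<close> to its parent \<open>u\<close>. The value \<open>weight \<Phi> v u\<close> is
  relevant only if \<open>(v, u)\<close> is an edge and \<open>u\<close> is a sum node.\<close>

record ('a, 'v) circuit =
  nodes :: "'a set"
  edges :: "('a \<times> 'a) set"
  label :: "'a \<Rightarrow> 'v label"
  weight :: "'a \<Rightarrow> 'a \<Rightarrow> real"

definition children :: "('a, 'v) circuit \<Rightarrow> 'a \<Rightarrow> 'a set" where
  "children \<Phi> u = {v. (v, u) \<in> edges \<Phi>}"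

definition leaves :: "('a, 'v) circuit \<Rightarrow> 'a set" where
  "leaves \<Phi> = {u \<in> nodes \<Phi>. children \<Phi> u = {}}"

definition is_root :: "('a, 'v) circuit \<Rightarrow> 'a \<Rightarrow> bool" where
  "is_root \<Phi> u \<longleftrightarrow> u \<in> nodes \<Phi> \<and> (\<forall>v. (u, v) \<notin> edges \<Phi>)"

definition root_node :: "('a, 'v) circuit \<Rightarrow> 'a" where
  "root_node \<Phi> = (THE u. is_root \<Phi> u)"

definition arith_circuit :: "'v set \<Rightarrow> ('a, 'v) circuit \<Rightarrow> bool" where
  "arith_circuit Y \<Phi> \<longleftrightarrow>
     finite (nodes \<Phi>) \<and> edges \<Phi> \<subseteq> nodes \<Phi> \<times> nodes \<Phi> \<and> acyclic (edges \<Phi>) \<and>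
     (\<exists>!u. is_root \<Phi> u) \<and>
     (\<forall>u\<in>leaves \<Phi>. label \<Phi> u \<in> range Const \<union> Var ` Y) \<and>
     (\<forall>u\<in>nodes \<Phi> - leaves \<Phi>. label \<Phi> u \<in> {Prod, Sum})"

text \<open>Recursion along the edge relation, which is well-founded for arithmetic circuits; the
  recursive equation is \<open>node_poly_unfold\<close> below.\<close>

definition node_poly :: "('a, 'v) circuit \<Rightarrow> 'a \<Rightarrow> 'v rpoly" where
  "node_poly \<Phi> = wfrec (edges \<Phi>) (\<lambda>q u.
     case label \<Phi> u of
       Var y \<Rightarrow> poly_var y
     | Const c \<Rightarrow> poly_const c
     | Prod \<Rightarrow> (\<Prod>v\<in>children \<Phi> u. q v)
     | Sum \<Rightarrow> (\<Sum>v\<in>children \<Phi> u. poly_const (weight \<Phi> v u) * q v))"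

lemma node_poly_unfold:
  assumes "arith_circuit Y \<Phi>"
  shows "node_poly \<Phi> u =
    (case label \<Phi> u of
       Var y \<Rightarrow> poly_var y
     | Const c \<Rightarrow> poly_const c
     | Prod \<Rightarrow> (\<Prod>v\<in>children \<Phi> u. node_poly \<Phi> v)
     | Sum \<Rightarrow> (\<Sum>v\<in>children \<Phi> u. poly_const (weight \<Phi> v u) * node_poly \<Phi> v))"
proof -
  have "finite (edges \<Phi>)"
    using assms unfolding arith_circuit_def by (meson finite_SigmaI finite_subset)
  then have "wf (edges \<Phi>)"
    using assms unfolding arith_circuit_def by (simp add: finite_acyclic_wf)
  then show ?thesis
    by (subst node_poly_def, subst wfrec)
       (auto simp: node_poly_def children_def cut_apply split: label.split intro!: prod.cong sum.cong)
qed

definition circuit_poly :: "('a, 'v) circuit \<Rightarrow> 'v rpoly" where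
  "circuit_poly \<Phi> = node_poly \<Phi> (root_node \<Phi>)"

definition monotone_circuit :: "('a, 'v) circuit \<Rightarrow> bool" where
  "monotone_circuit \<Phi> \<longleftrightarrow>
     (\<forall>u\<in>nodes \<Phi>. \<forall>c. label \<Phi> u = Const c \<longrightarrow> 0 \<le> c) \<and>
     (\<forall>(v, u)\<in>edges \<Phi>. label \<Phi> u = Sum \<longrightarrow> 0 \<le> weight \<Phi> v u)"

text \<open>Layers are numbered from 1. A circuit of depth \<open>d\<close> is layered: all children of a node in
  layer \<open>k + 1\<close> lie in layer \<open>k\<close>, and layer \<open>d\<close> consists of the root.\<close>

fun layer :: "('a, 'v) circuit \<Rightarrow> nat \<Rightarrow> 'a set" where
  "layer \<Phi> 0 = {}"
| "layer \<Phi> (Suc 0) = leaves \<Phi>"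
| "layer \<Phi> (Suc (Suc k)) = {u \<in> nodes \<Phi> - leaves \<Phi>. children \<Phi> u \<subseteq> layer \<Phi> (Suc k)}"

definition has_depth :: "('a, 'v) circuit \<Rightarrow> nat \<Rightarrow> bool" where
  "has_depth \<Phi> d \<longleftrightarrow> nodes \<Phi> = (\<Union>k\<in>{1..d}. layer \<Phi> k) \<and> layer \<Phi> d = {root_node \<Phi>}"

text \<open>The circuit variable \<open>(i, j)\<close> stands for the function \<open>f i j\<close> of \<open>x i\<close>, where \<open>1 \<le> i \<le> n\<close>
  and \<open>1 \<le> j \<le> m i\<close>.\<close>

definition spn ::
  "nat \<Rightarrow> (nat \<Rightarrow> nat) \<Rightarrow> (nat \<Rightarrow> nat \<Rightarrow> nat \<Rightarrow> real) \<Rightarrow> ('a, nat \<times> nat) circuit \<Rightarrow> bool" where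
  "spn n m f \<Phi> \<longleftrightarrow>
     (\<forall>i\<in>{1..n}. \<forall>j\<in>{1..m i}. \<forall>b\<in>{0, 1}. 0 \<le> f i j b) \<and>
     arith_circuit (SIGMA i:{1..n}. {1..m i}) \<Phi> \<and> monotone_circuit \<Phi>"

definition spn_fun ::
  "(nat \<Rightarrow> nat \<Rightarrow> nat \<Rightarrow> real) \<Rightarrow> ('a, nat \<times> nat) circuit \<Rightarrow> (nat \<Rightarrow> nat) \<Rightarrow> real" where
  "spn_fun f \<Phi> x = poly_eval (\<lambda>(i, j). f i j (x i)) (circuit_poly \<Phi>)"

definition dep_scope :: "('a, nat \<times> nat) circuit \<Rightarrow> 'a \<Rightarrow> nat set" where
  "dep_scope \<Phi> u = {i. \<exists>v j. (v, u) \<in> (edges \<Phi>)\<^sup>* \<and> label \<Phi> v = Var (i, j)}"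

definition decomposable :: "('a, nat \<times> nat) circuit \<Rightarrow> bool" where
  "decomposable \<Phi> \<longleftrightarrow>
     (\<forall>u\<in>nodes \<Phi>. label \<Phi> u = Prod \<longrightarrow> disjoint_family_on (dep_scope \<Phi>) (children \<Phi> u))"

definition complete_circuit :: "('a, nat \<times> nat) circuit \<Rightarrow> bool" where
  "complete_circuit \<Phi> \<longleftrightarrow>
     (\<forall>u\<in>nodes \<Phi>. label \<Phi> u = Sum \<longrightarrow>
        (\<forall>v\<in>children \<Phi> u. \<forall>w\<in>children \<Phi> u. dep_scope \<Phi> v = dep_scope \<Phi> w))"

definition dc_spn ::
  "nat \<Rightarrow> (nat \<Rightarrow> nat) \<Rightarrow> (nat \<Rightarrow> nat \<Rightarrow> nat \<Rightarrow> real) \<Rightarrow> ('a, nat \<times> nat) circuit \<Rightarrow> bool" where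
  "dc_spn n m f \<Phi> \<longleftrightarrow> spn n m f \<Phi> \<and> decomposable \<Phi> \<and> complete_circuit \<Phi>"

definition EQUAL :: "nat \<Rightarrow> (nat \<Rightarrow> nat) \<Rightarrow> real" where
  "EQUAL n x = (if \<forall>i\<in>{1..n div 2}. x i = x (n div 2 + i) then 1 else 0)"

end

theory Submission imports Defs begin

text \<open>A node of the second layer computes a product of univariate functions: a product node by
  definition, and a sum node because completeness forces all its leaves to depend on the same
  variable. For such a function \<open>g\<close>, exchanging the second halves of the inputs \<open>(a, a)\<close> and
  \<open>(b, b)\<close> gives \<open>g (a, b) * g (b, a) = g (a, a) * g (b, b)\<close>. A product root would inherit this
  identity, which \<open>EQUAL\<close> violates as soon as \<open>n \<ge> 2\<close>. For a sum root, every \<open>a\<close> has a child that is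
  positive at \<open>(a, a)\<close>; if \<open>a \<noteq> b\<close> shared such a child, it would be positive at \<open>(a, b)\<close>, and by
  monotonicity so would the root. Hence distinct \<open>a\<close> need distinct nodes of the second layer.\<close>

section \<open>Evaluation of polynomials\<close>

definition monom_eval :: "('v \<Rightarrow> real) \<Rightarrow> ('v \<Rightarrow>\<^sub>0 nat) \<Rightarrow> real" where
  "monom_eval a m = (\<Prod>v\<in>Poly_Mapping.keys m. a v ^ Poly_Mapping.lookup m v)"

text \<open>Enlarging the index set only adds factors with exponent 0, so two monomials can be
  evaluated over one common finite set of variables.\<close>

lemma monom_eval_superset:
  assumes "finite V" "Poly_Mapping.keys m \<subseteq> V"
  shows "monom_eval a m = (\<Prod>v\<in>V. a v ^ Poly_Mapping.lookup m v)"
  unfolding monom_eval_def using assms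
  by (intro prod.mono_neutral_left) (auto simp: in_keys_iff)

lemma monom_eval_add: "monom_eval a (m + m') = monom_eval a m * monom_eval a m'"
proof -
  let ?V = "Poly_Mapping.keys m \<union> Poly_Mapping.keys m'"
  have "monom_eval a (m + m') = (\<Prod>v\<in>?V. a v ^ Poly_Mapping.lookup (m + m') v)"
    by (intro monom_eval_superset) (auto simp: Poly_Mapping.keys_add)
  also have "\<dots> = monom_eval a m * monom_eval a m'"
    by (simp add: monom_eval_superset[of ?V] lookup_add power_add prod.distrib)
  finally show ?thesis .
qed

lemma poly_eval_superset:
  assumes "finite M" "Poly_Mapping.keys p \<subseteq> M"
  shows "poly_eval a p = (\<Sum>m\<in>M. Poly_Mapping.lookup p m * monom_eval a m)"
  unfolding poly_eval_def monom_eval_def using assms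
  by (intro sum.mono_neutral_left) (auto simp: in_keys_iff)

lemma poly_eval_zero [simp]: "poly_eval a 0 = 0"
  by (simp add: poly_eval_def)

lemma poly_eval_add: "poly_eval a (p + q) = poly_eval a p + poly_eval a q"
proof -
  let ?M = "Poly_Mapping.keys p \<union> Poly_Mapping.keys q"
  have "poly_eval a (p + q) = (\<Sum>m\<in>?M. Poly_Mapping.lookup (p + q) m * monom_eval a m)"
    by (intro poly_eval_superset) (auto simp: Poly_Mapping.keys_add)
  also have "\<dots> = poly_eval a p + poly_eval a q"
    by (simp add: poly_eval_superset[of ?M] lookup_add distrib_right sum.distrib)
  finally show ?thesis .
qed

lemma poly_eval_single: "poly_eval a (Poly_Mapping.single m c) = c * monom_eval a m"
  by (subst poly_eval_superset[of "{m}"]) auto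

lemma poly_eval_const [simp]: "poly_eval a (poly_const c) = c"
  by (simp add: poly_const_def poly_eval_single monom_eval_def)

lemma poly_eval_var [simp]: "poly_eval a (poly_var v) = a v"
  by (simp add: poly_var_def poly_eval_single monom_eval_def)

text \<open>Every finitely supported map is a finite sum of single terms, so statements additive in
  \<open>p\<close> reduce to one term.\<close>

lemma poly_mapping_decompose_induct [case_names zero add]:
  fixes p :: "'a \<Rightarrow>\<^sub>0 'b::comm_monoid_add"
  assumes "P 0"
    and "\<And>k c q. P q \<Longrightarrow> P (Poly_Mapping.single k c + q)"
  shows "P p"
proof (induction p rule: update_induct)
  case (update p k c)
  \<comment> \<open>The key \<open>k\<close> is absent from \<open>p\<close>, so overwriting its
    coefficient amounts to adding a term.\<close>
  have "Poly_Mapping.update k c p = Poly_Mapping.single k c + p"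
    using update by (intro poly_mapping_eqI)
      (auto simp: lookup_update lookup_add lookup_single in_keys_iff when_def)
  with update assms(2) show ?case by simp
qed (rule assms(1))

text \<open>By bilinearity, two nested inductions leave a product of two single terms, where
  \<open>monom_eval_add\<close> applies.\<close>

lemma poly_eval_mult: "poly_eval a (p * q) = poly_eval a p * poly_eval a q"
proof (induction p rule: poly_mapping_decompose_induct)
  case (add k c p)
  have "poly_eval a (Poly_Mapping.single k c * q) = c * monom_eval a k * poly_eval a q"
    by (induction q rule: poly_mapping_decompose_induct)
      (auto simp: distrib_left poly_eval_add mult_single poly_eval_single monom_eval_add)
  with add show ?case
    by (simp add: distrib_right poly_eval_add poly_eval_single)
qed simp

lemma poly_eval_one [simp]: "poly_eval a 1 = 1"
  using poly_eval_const[of a 1] by (simp add: poly_const_def)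

lemma poly_eval_sum: "poly_eval a (\<Sum>i\<in>I. p i) = (\<Sum>i\<in>I. poly_eval a (p i))"
  by (induction I rule: infinite_finite_induct) (auto simp: poly_eval_add)

lemma poly_eval_prod: "poly_eval a (\<Prod>i\<in>I. p i) = (\<Prod>i\<in>I. poly_eval a (p i))"
  by (induction I rule: infinite_finite_induct) (auto simp: poly_eval_mult)

section \<open>Values of circuit nodes\<close>

definition node_value :: "('v \<Rightarrow> real) \<Rightarrow> ('a, 'v) circuit \<Rightarrow> 'a \<Rightarrow> real" where
  "node_value a \<Phi> u = poly_eval a (node_poly \<Phi> u)"

lemma node_value_unfold:
  assumes "arith_circuit Y \<Phi>"
  shows "node_value a \<Phi> u =
    (case label \<Phi> u of
       Var y \<Rightarrow> a y
     | Const c \<Rightarrow> c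
     | Prod \<Rightarrow> (\<Prod>v\<in>children \<Phi> u. node_value a \<Phi> v)
     | Sum \<Rightarrow> (\<Sum>v\<in>children \<Phi> u. weight \<Phi> v u * node_value a \<Phi> v))"
  unfolding node_value_def
  by (subst node_poly_unfold[OF assms])
    (simp add: poly_eval_sum poly_eval_prod poly_eval_mult split: label.split)

lemma wf_edges:
  assumes "arith_circuit Y \<Phi>"
  shows "wf (edges \<Phi>)"
proof -
  have "finite (edges \<Phi>)"
    using assms unfolding arith_circuit_def by (meson finite_SigmaI finite_subset)
  then show ?thesis
    using assms unfolding arith_circuit_def by (simp add: finite_acyclic_wf)
qed

lemma children_subset_nodes: "arith_circuit Y \<Phi> \<Longrightarrow> children \<Phi> u \<subseteq> nodes \<Phi>"
  by (auto simp: arith_circuit_def children_def)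

lemma leaf_label: "arith_circuit Y \<Phi> \<Longrightarrow> u \<in> leaves \<Phi> \<Longrightarrow> label \<Phi> u \<in> range Const \<union> Var ` Y"
  by (auto simp: arith_circuit_def)

lemma inner_label:
  "arith_circuit Y \<Phi> \<Longrightarrow> u \<in> nodes \<Phi> \<Longrightarrow> u \<notin> leaves \<Phi> \<Longrightarrow> label \<Phi> u = Prod \<or> label \<Phi> u = Sum"
  by (auto simp: arith_circuit_def)

lemma node_value_nonneg:
  assumes arith: "arith_circuit Y \<Phi>" and mono: "monotone_circuit \<Phi>"
    and nonneg: "\<And>y. y \<in> Y \<Longrightarrow> 0 \<le> a y"
    and "u \<in> nodes \<Phi>"
  shows "0 \<le> node_value a \<Phi> u"
  using wf_edges[OF arith] \<open>u \<in> nodes \<Phi>\<close>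
proof (induction u rule: wf_induct_rule)
  case (less u)
  have IH: "0 \<le> node_value a \<Phi> v" if "v \<in> children \<Phi> u" for v
    using less that children_subset_nodes[OF arith, of u] by (auto simp: children_def)
  \<comment> \<open>Inner nodes carry only \<open>Prod\<close> or \<open>Sum\<close>, so a node
    labelled by a variable is a leaf and that variable lies in \<open>Y\<close>.\<close>
  have "0 \<le> a y" if "label \<Phi> u = Var y" for y
    using leaf_label[OF arith, of u] inner_label[OF arith less.prems] nonneg that by auto
  moreover have "0 \<le> c" if "label \<Phi> u = Const c" for c
    using mono less.prems that by (auto simp: monotone_circuit_def)
  moreover have "0 \<le> weight \<Phi> v u" if "label \<Phi> u = Sum" "v \<in> children \<Phi> u" for v
    using mono that by (auto simp: monotone_circuit_def children_def)
  ultimately show ?case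
    by (subst node_value_unfold[OF arith])
      (auto split: label.split intro!: prod_nonneg sum_nonneg mult_nonneg_nonneg IH)
qed

section \<open>Dependency scopes\<close>

lemma dep_scope_child: "v \<in> children \<Phi> u \<Longrightarrow> dep_scope \<Phi> v \<subseteq> dep_scope \<Phi> u"
  by (auto simp: dep_scope_def children_def dest: rtrancl_into_rtrancl)

lemma dep_scope_eq:
  "dep_scope \<Phi> u = {i. \<exists>j. label \<Phi> u = Var (i, j)} \<union> (\<Union>v\<in>children \<Phi> u. dep_scope \<Phi> v)"
proof
  show "dep_scope \<Phi> u \<subseteq> {i. \<exists>j. label \<Phi> u = Var (i, j)} \<union> (\<Union>v\<in>children \<Phi> u. dep_scope \<Phi> v)"
    by (auto simp: dep_scope_def children_def elim: rtranclE)
  show "{i. \<exists>j. label \<Phi> u = Var (i, j)} \<union> (\<Union>v\<in>children \<Phi> u. dep_scope \<Phi> v) \<subseteq> dep_scope \<Phi> u"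
    using dep_scope_child by (fastforce simp: dep_scope_def)
qed

text \<open>Scopes can only shrink when passing to children, so agreement on the scope of
  \<open>u\<close> is inherited down to the leaves.\<close>

lemma node_value_cong_dep_scope:
  assumes arith: "arith_circuit Y \<Phi>"
    and "\<And>i j. i \<in> dep_scope \<Phi> u \<Longrightarrow> a (i, j) = b (i, j)"
  shows "node_value a \<Phi> u = node_value b \<Phi> u"
  using wf_edges[OF arith] assms(2)
proof (induction u rule: wf_induct_rule)
  case (less u)
  have IH: "node_value a \<Phi> v = node_value b \<Phi> v" if "v \<in> children \<Phi> u" for v
    using that dep_scope_child[OF that] by (intro less) (auto simp: children_def)
  have "a y = b y" if "label \<Phi> u = Var y" for y
    using less.prems[of "fst y" "snd y"] that dep_scope_eq[of \<Phi> u] by (cases y) auto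
  then show ?case
    by (subst (1 2) node_value_unfold[OF arith])
      (auto split: label.split intro!: prod.cong sum.cong IH)
qed

text \<open>Inclusion rather than equality, because a leaf labelled by a constant has empty
  scope.\<close>

lemma dep_scope_leaf:
  assumes "u \<in> leaves \<Phi>"
  shows "\<exists>i. dep_scope \<Phi> u \<subseteq> {i}"
  using assms by (cases "label \<Phi> u") (auto simp: dep_scope_eq[of \<Phi> u] leaves_def)

lemma dep_scope_sum_of_leaves:
  assumes "complete_circuit \<Phi>" "u \<in> nodes \<Phi>" "label \<Phi> u = Sum" "children \<Phi> u \<subseteq> leaves \<Phi>"
  shows "\<exists>i. dep_scope \<Phi> u \<subseteq> {i}"
proof (cases "children \<Phi> u = {}")
  case True
  then show ?thesis by (simp add: dep_scope_eq[of \<Phi> u] assms(3))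
next
  case False
  then obtain v where v: "v \<in> children \<Phi> u" by blast
  then have "dep_scope \<Phi> w = dep_scope \<Phi> v" if "w \<in> children \<Phi> u" for w
    using assms that unfolding complete_circuit_def by blast
  then have "dep_scope \<Phi> u \<subseteq> dep_scope \<Phi> v"
    using assms(3) by (auto simp: dep_scope_eq[of \<Phi> u])
  then show ?thesis
    using dep_scope_leaf[of v \<Phi>] v assms(4) by blast
qed

section \<open>The exchange identity\<close>

text \<open>The function \<open>override_on y x A\<close> follows \<open>x\<close> on
  \<open>A\<close> and \<open>y\<close> elsewhere. View \<open>g\<close> as a matrix with rows
  indexed by the values on \<open>A\<close> and columns by the values off \<open>A\<close>: the
  identity says that all 2 by 2 minors vanish, that is, the rank is at most 1.\<close>

definition exchangeable :: "'i set \<Rightarrow> (('i \<Rightarrow> 'b) \<Rightarrow> real) \<Rightarrow> bool" where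
  "exchangeable A g \<longleftrightarrow>
     (\<forall>x y. g (override_on y x A) * g (override_on x y A) = g x * g y)"

lemma exchangeableD:
  "exchangeable A g \<Longrightarrow> g (override_on y x A) * g (override_on x y A) = g x * g y"
  by (simp add: exchangeable_def)

lemma exchangeable_prod:
  assumes "\<And>v. v \<in> V \<Longrightarrow> exchangeable A (g v)"
  shows "exchangeable A (\<lambda>x. \<Prod>v\<in>V. g v x)"
  unfolding exchangeable_def prod.distrib[symmetric]
  using assms by (auto intro!: prod.cong dest: exchangeableD)

text \<open>The exchange either leaves coordinate \<open>i\<close> of both points alone or swaps the
  two values, and the product is symmetric.\<close>

lemma exchangeable_univariate:
  assumes "\<And>x y. x i = y i \<Longrightarrow> g x = g y"
  shows "exchangeable A g"
  unfolding exchangeable_def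
proof (intro allI)
  fix x y
  show "g (override_on y x A) * g (override_on x y A) = g x * g y"
  proof (cases "i \<in> A")
    case True
    then have "g (override_on y x A) = g x" "g (override_on x y A) = g y"
      by (auto intro!: assms)
    then show ?thesis by simp
  next
    case False
    then have "g (override_on y x A) = g y" "g (override_on x y A) = g x"
      by (auto intro!: assms)
    then show ?thesis by simp
  qed
qed

definition input_value ::
  "(nat \<Rightarrow> nat \<Rightarrow> nat \<Rightarrow> real) \<Rightarrow> ('a, nat \<times> nat) circuit \<Rightarrow> 'a \<Rightarrow> (nat \<Rightarrow> nat) \<Rightarrow> real" where
  "input_value f \<Phi> u x = node_value (\<lambda>(i, j). f i j (x i)) \<Phi> u"

lemma spn_fun_eq_input_value: "spn_fun f \<Phi> x = input_value f \<Phi> (root_node \<Phi>) x"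
  by (simp add: spn_fun_def circuit_poly_def input_value_def node_value_def)

lemma input_value_Prod:
  "arith_circuit Y \<Phi> \<Longrightarrow> label \<Phi> u = Prod \<Longrightarrow>
    input_value f \<Phi> u = (\<lambda>x. \<Prod>v\<in>children \<Phi> u. input_value f \<Phi> v x)"
  by (simp add: input_value_def node_value_unfold[of Y \<Phi> _ u] fun_eq_iff)

lemma input_value_Sum:
  "arith_circuit Y \<Phi> \<Longrightarrow> label \<Phi> u = Sum \<Longrightarrow>
    input_value f \<Phi> u x = (\<Sum>v\<in>children \<Phi> u. weight \<Phi> v u * input_value f \<Phi> v x)"
  by (simp add: input_value_def node_value_unfold[of Y \<Phi> _ u])

lemma exchangeable_small_scope:
  assumes "arith_circuit Y \<Phi>" "dep_scope \<Phi> u \<subseteq> {i}"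
  shows "exchangeable A (input_value f \<Phi> u)"
proof (rule exchangeable_univariate)
  fix x y :: "nat \<Rightarrow> nat"
  assume "x i = y i"
  then show "input_value f \<Phi> u x = input_value f \<Phi> u y"
    unfolding input_value_def using assms
    by (intro node_value_cong_dep_scope[OF assms(1)]) auto
qed

lemma layer_2_eq: "layer \<Phi> 2 = {u \<in> nodes \<Phi> - leaves \<Phi>. children \<Phi> u \<subseteq> leaves \<Phi>}"
  by (simp add: numeral_2_eq_2)

lemma layer_3_eq: "layer \<Phi> 3 = {u \<in> nodes \<Phi> - leaves \<Phi>. children \<Phi> u \<subseteq> layer \<Phi> 2}"
  by (simp add: numeral_3_eq_3 numeral_2_eq_2)

lemma exchangeable_layer_2:
  assumes arith: "arith_circuit Y \<Phi>" and comp: "complete_circuit \<Phi>" and u: "u \<in> layer \<Phi> 2"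
  shows "exchangeable A (input_value f \<Phi> u)"
proof -
  have u': "u \<in> nodes \<Phi>" "u \<notin> leaves \<Phi>" "children \<Phi> u \<subseteq> leaves \<Phi>"
    using u by (auto simp: layer_2_eq)
  from inner_label[OF arith u'(1,2)] show ?thesis
  proof
    assume "label \<Phi> u = Prod"
    then show ?thesis
      using u'(3) dep_scope_leaf[of _ \<Phi>] exchangeable_small_scope[OF arith]
      by (subst input_value_Prod[OF arith]) (blast intro!: exchangeable_prod)+
  next
    assume "label \<Phi> u = Sum"
    then show ?thesis
      using dep_scope_sum_of_leaves[OF comp u'(1) _ u'(3)] exchangeable_small_scope[OF arith]
      by blast
  qed
qed

section \<open>The lower bound\<close>

text \<open>The restriction to \<open>{1..n}\<close> places the word in the extensional function
  space over which the inputs range.\<close>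

definition half_concat :: "nat \<Rightarrow> (nat \<Rightarrow> nat) \<Rightarrow> (nat \<Rightarrow> nat) \<Rightarrow> nat \<Rightarrow> nat" where
  "half_concat n a b =
     restrict (\<lambda>i. if i \<le> n div 2 then a i else b (i - n div 2)) {1..n}"

lemma half_concat_in:
  assumes "even n" "a \<in> {1..n div 2} \<rightarrow>\<^sub>E {0, 1}" "b \<in> {1..n div 2} \<rightarrow>\<^sub>E {0, 1}"
  shows "half_concat n a b \<in> {1..n} \<rightarrow>\<^sub>E {0, 1}"
proof -
  have "a i \<in> {0, 1}" "b i \<in> {0, 1}" if "1 \<le> i" "i \<le> n div 2" for i
    using assms(2,3) that by (auto simp: PiE_iff)
  \<comment> \<open>Evenness matters here: for odd \<open>n\<close> the last position would read
    \<open>b\<close> at \<open>n div 2 + 1\<close>, outside its domain.\<close>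
  moreover have "i - n div 2 \<le> n div 2" if "i \<le> n" for i
    using that assms(1) by presburger
  ultimately show ?thesis
    by (auto simp: half_concat_def PiE_iff extensional_def not_le)
qed

lemma EQUAL_half_concat:
  assumes "even n" "a \<in> {1..n div 2} \<rightarrow>\<^sub>E {0, 1}" "b \<in> {1..n div 2} \<rightarrow>\<^sub>E {0, 1}"
  shows "EQUAL n (half_concat n a b) = (if a = b then 1 else 0)"
proof -
  have "n = n div 2 + n div 2"
    using assms(1) by presburger
  then have "half_concat n a b i = a i" "half_concat n a b (n div 2 + i) = b i"
    if "i \<in> {1..n div 2}" for i
    using that by (auto simp: half_concat_def)
  moreover have "a = b \<longleftrightarrow> (\<forall>i\<in>{1..n div 2}. a i = b i)"
    using assms(2,3) by (auto intro: PiE_ext)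
  ultimately show ?thesis
    by (simp add: EQUAL_def)
qed

lemma override_on_half_concat:
  "override_on (half_concat n b b') (half_concat n a a') {1..n div 2} = half_concat n a b'"
  by (auto simp: fun_eq_iff override_on_def half_concat_def)

text \<open>This is the exchange identity at the points (a, a) and (b, b).\<close>

lemma exchangeable_half_concat:
  assumes "exchangeable {1..n div 2} g"
  shows "g (half_concat n a b) * g (half_concat n b a) = g (half_concat n a a) * g (half_concat n b b)"
  using exchangeableD[OF assms, of "half_concat n b b" "half_concat n a a"]
  unfolding override_on_half_concat .

theorem corollary25:
  fixes n :: nat and m :: "nat \<Rightarrow> nat"
    and f :: "nat \<Rightarrow> nat \<Rightarrow> nat \<Rightarrow> real"
    and \<Phi> :: "('a, nat \<times> nat) circuit"
  assumes "even n"
    and "dc_spn n m f \<Phi>"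
    and "has_depth \<Phi> 3"
    and "\<forall>x\<in>{1..n} \<rightarrow>\<^sub>E {0, 1}. spn_fun f \<Phi> x = EQUAL n x"
  shows "card (layer \<Phi> 2) \<ge> 2 ^ (n div 2)"
proof -
  let ?B = "{1..n div 2} \<rightarrow>\<^sub>E {0, 1::nat}"
  let ?c = "half_concat n" and ?r = "root_node \<Phi>"
  define g where "g = input_value f \<Phi>"
  have arith: "arith_circuit (SIGMA i:{1..n}. {1..m i}) \<Phi>"
    and mono: "monotone_circuit \<Phi>" and comp: "complete_circuit \<Phi>"
    and fnn: "\<And>i j b. i \<in> {1..n} \<Longrightarrow> j \<in> {1..m i} \<Longrightarrow> b \<in> {0, 1} \<Longrightarrow> 0 \<le> f i j b"
    using assms(2) by (auto simp: dc_spn_def spn_def)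
  have "?r \<in> layer \<Phi> 3"
    using assms(3) by (simp add: has_depth_def)
  then have r: "?r \<in> nodes \<Phi>" "?r \<notin> leaves \<Phi>" "children \<Phi> ?r \<subseteq> layer \<Phi> 2"
    by (auto simp: layer_3_eq)
  then have ne: "layer \<Phi> 2 \<noteq> {}"
    by (auto simp: leaves_def)
  have "finite (nodes \<Phi>)"
    using arith by (simp add: arith_circuit_def)
  then have fin: "finite (layer \<Phi> 2)"
    by (simp add: layer_2_eq)
  have ex: "exchangeable {1..n div 2} (g u)" if "u \<in> layer \<Phi> 2" for u
    using exchangeable_layer_2[OF arith comp that] by (simp add: g_def)
  have root: "g ?r (?c a b) = (if a = b then 1 else 0)" if "a \<in> ?B" "b \<in> ?B" for a b
    using assms(4) half_concat_in[OF assms(1) that] EQUAL_half_concat[OF assms(1) that]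
    by (simp add: g_def spn_fun_eq_input_value[symmetric])
  from inner_label[OF arith r(1,2)] show ?thesis
  proof
    assume lab: "label \<Phi> ?r = Prod"
    have "exchangeable {1..n div 2} (g ?r)"
      unfolding g_def input_value_Prod[OF arith lab]
      using r(3) ex by (auto intro!: exchangeable_prod simp: g_def)
    \<comment> \<open>For \<open>a\<close> different from \<open>b\<close> the identity would read 0
      * 0 = 1 * 1.\<close>
    then have all_eq: "a = b" if "a \<in> ?B" "b \<in> ?B" for a b
      using exchangeable_half_concat[of n "g ?r" a b] root that by (auto split: if_splits)
    have "n div 2 = 0"
    proof (rule ccontr)
      assume "n div 2 \<noteq> 0"
      then have one: "1 \<in> {1..n div 2}" by simp
      \<comment> \<open>The all-zero and all-one words differ as soon as a half has a
        position.\<close>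
      have "restrict (\<lambda>_. 0) {1..n div 2} = restrict (\<lambda>_. 1::nat) {1..n div 2}"
        by (intro all_eq) auto
      from fun_cong[OF this, of 1] one show False by simp
    qed
    \<comment> \<open>The bound is now \<open>2 ^ 0 = 1\<close>, which a child of the root in the
      second layer provides.\<close>
    then show ?thesis
      using ne fin by (simp add: Suc_le_eq card_gt_0_iff)
  next
    assume lab: "label \<Phi> ?r = Sum"
    have gsum: "g ?r x = (\<Sum>v\<in>children \<Phi> ?r. weight \<Phi> v ?r * g v x)" for x
      by (simp add: g_def input_value_Sum[OF arith lab])
    have nn: "0 \<le> g v (?c a b)" if "v \<in> children \<Phi> ?r" "a \<in> ?B" "b \<in> ?B" for v a b
      unfolding g_def input_value_def
    proof (rule node_value_nonneg[OF arith mono])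
      show "v \<in> nodes \<Phi>" using that(1) children_subset_nodes[OF arith] by blast
      \<comment> \<open>Each \<open>f i j\<close> is known to be non-negative only at 0 and 1, so
        the concatenated input has to be Boolean.\<close>
      show "0 \<le> (case y of (i, j) \<Rightarrow> f i j (?c a b i))" if "y \<in> (SIGMA i:{1..n}. {1..m i})" for y
        using that half_concat_in[OF assms(1) \<open>a \<in> ?B\<close> \<open>b \<in> ?B\<close>]
        by (auto intro!: fnn simp: PiE_iff simp del: insert_iff)
    qed
    have wnn: "0 \<le> weight \<Phi> v ?r" if "v \<in> children \<Phi> ?r" for v
      using mono lab that by (auto simp: monotone_circuit_def children_def)
    have "\<exists>v\<in>children \<Phi> ?r. weight \<Phi> v ?r * g v (?c a a) \<noteq> 0" if "a \<in> ?B" for a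
    proof (rule ccontr)
      assume "\<not> ?thesis"
      then have "g ?r (?c a a) = 0"
        unfolding gsum by (intro sum.neutral) blast
      then show False
        using root[OF that that] by simp
    qed
    \<comment> \<open>The map \<open>h\<close> picks for each \<open>a\<close> a child whose
      weighted contribution at (a, a) is nonzero; its edge weight is then nonzero too.\<close>
    then obtain h where h: "\<And>a. a \<in> ?B \<Longrightarrow> h a \<in> children \<Phi> ?r"
      and h_pos: "\<And>a. a \<in> ?B \<Longrightarrow> weight \<Phi> (h a) ?r * g (h a) (?c a a) \<noteq> 0"
      by metis
    have "inj_on h ?B"
    proof (rule inj_onI, rule ccontr)
      fix a b assume ab: "a \<in> ?B" "b \<in> ?B" "h a = h b" "a \<noteq> b"
      have "g (h a) (?c a b) * g (h a) (?c b a) = g (h a) (?c a a) * g (h a) (?c b b)"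
        using exchangeable_half_concat ex h[OF ab(1)] r(3) by blast
      \<comment> \<open>Since \<open>h a = h b\<close>, both factors on the right of the identity
        are nonzero, hence so are those on the left.\<close>
      then have "weight \<Phi> (h a) ?r * g (h a) (?c a b) \<noteq> 0"
        using h_pos[OF ab(1)] h_pos[OF ab(2)] ab(3) by auto
      moreover have "finite (children \<Phi> ?r)"
        using fin r(3) finite_subset by blast
      \<comment> \<open>No cancellation is possible: a sum of non-negative terms vanishes only if
        every term does.\<close>
      ultimately have "g ?r (?c a b) \<noteq> 0"
        using h[OF ab(1)] nn[OF _ ab(1,2)] wnn unfolding gsum by (subst sum_nonneg_eq_0_iff) auto
      then show False
        using root[OF ab(1,2)] ab(4) by simp
    qed
    moreover have "h ` ?B \<subseteq> layer \<Phi> 2"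
      using h r(3) by blast
    ultimately have "card ?B \<le> card (layer \<Phi> 2)"
      using fin by (intro card_inj_on_le) auto
    then show ?thesis
      by (simp add: card_PiE numeral_2_eq_2)
  qed
qed

end
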